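(* For any collection of $2^n\times 2^n$ Hermitian observables $O_1,\dots,O_M$ with $\|O_i\|_\infty\le1$ and any $\epsilon>0$, there is a learning algorithm without quantum memory that uses $$T\le\mathcal{O}\!\left(\frac{\min(M\log M,\ 2^n\log M)}{\epsilon^2}\right)$$ copies of an unknown $n$-qubit state $\rho$ and, with high (constant, e.g. at least $0.99$) probability, outputs estimates of $\mathrm{Tr}(O_x\rho)$ within additive error $\epsilon$ simultaneously for all $x=1,\dots,M$.
   Context: $\|\cdot\|_\infty$ is the operator norm. An $n$-qubit state is a $2^n\times 2^n$ positive semidefinite complex matrix of trace one. A learning algorithm without quantum memory using $T$ copies of an unknown $n$-qubit state $\rho$ proceeds in $T$ rounds: in each round it receives a fresh copy of $\rho$, chooses a POVM $\{F_s\}_s$ on $n$ qubits (positive semidefinite matrices with $\sum_s F_s=I$), where the choice may depend arbitrarily on all previously observed classical outcomes (and on internal classical randomness), and observes outcome $s$ with probability $\mathrm{Tr}(F_s\rho)$; no quantum state is retained between rounds. Its final output is an arbitrary function of the observed classical outcomes.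
   Formalization: The bound is stated with log(M+1) in place of log M: for M=1 the literal bound would allow zero copies, which is impossible (e.g. O=Z, ε=0.1); for M≥2 the two bounds agree up to the constant. *)

theory Defs
  imports "Jordan_Normal_Form.Matrix" "HOL-Probability.Probability_Mass_Function"
begin

(* Complex d x d matrices are Jordan_Normal_Form matrices "complex mat" in carrier_mat d d.
   Vectors in C^d are represented as functions nat => complex (only indices < d matter). *)

definition mtrace :: "complex mat \<Rightarrow> complex" where
  "mtrace A = (\<Sum>i<dim_row A. A $$ (i,i))"

definition hermitian_mat :: "complex mat \<Rightarrow> bool" where
  "hermitian_mat A \<longleftrightarrow> square_mat A \<and>
     (\<forall>i<dim_row A. \<forall>j<dim_row A. A $$ (i,j) = cnj (A $$ (j,i)))"

definition psd_mat :: "nat \<Rightarrow> complex mat \<Rightarrow> bool" where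
  "psd_mat d A \<longleftrightarrow> A \<in> carrier_mat d d \<and> hermitian_mat A \<and>
     (\<forall>v :: nat \<Rightarrow> complex.
        let q = (\<Sum>i<d. \<Sum>j<d. cnj (v i) * A $$ (i,j) * v j) in Im q = 0 \<and> Re q \<ge> 0)"

definition cvec_norm :: "nat \<Rightarrow> (nat \<Rightarrow> complex) \<Rightarrow> real" where
  "cvec_norm d v = sqrt (\<Sum>i<d. (cmod (v i))\<^sup>2)"

definition op_norm :: "complex mat \<Rightarrow> real" where
  "op_norm A = Sup {cvec_norm (dim_row A) (\<lambda>i. \<Sum>j<dim_col A. A $$ (i,j) * v j) | v.
                      cvec_norm (dim_col A) v = 1}"

definition is_state :: "nat \<Rightarrow> complex mat \<Rightarrow> bool" where
  "is_state n \<rho> \<longleftrightarrow> psd_mat (2^n) \<rho> \<and> mtrace \<rho> = 1"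

(* A POVM with finitely many outcomes {0..<k} is a pair (k, F); valid on n qubits if
   every F s (s<k) is PSD of size 2^n and the F s sum to the identity. *)
type_synonym povm = "nat \<times> (nat \<Rightarrow> complex mat)"

definition is_povm :: "nat \<Rightarrow> povm \<Rightarrow> bool" where
  "is_povm n P \<longleftrightarrow> (case P of (k, F) \<Rightarrow>
     (\<forall>s<k. psd_mat (2^n) (F s)) \<and>
     (\<forall>i<2^n. \<forall>j<2^n. (\<Sum>s<k. F s $$ (i,j)) = (if i = j then 1 else 0)))"

(* A deterministic adaptive strategy without quantum memory: the POVM used in round t
   is a function of the list of previously observed outcomes (chronological order);
   the final output (estimates for each observable index) is a function of all outcomes. *)
type_synonym strategy = "nat list \<Rightarrow> povm"
type_synonym estimator = "nat list \<Rightarrow> nat \<Rightarrow> real"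

definition valid_strategy :: "nat \<Rightarrow> strategy \<Rightarrow> bool" where
  "valid_strategy n S \<longleftrightarrow> (\<forall>h. is_povm n (S h))"

definition histories :: "strategy \<Rightarrow> nat \<Rightarrow> nat list set" where
  "histories S T = {h. length h = T \<and> (\<forall>i<T. h ! i < fst (S (take i h)))}"

(* probability of observing history h, each round on a fresh copy of rho:
   product of Tr(F_s rho) *)
definition hist_prob :: "complex mat \<Rightarrow> strategy \<Rightarrow> nat list \<Rightarrow> real" where
  "hist_prob \<rho> S h = (\<Prod>i<length h. Re (mtrace (snd (S (take i h)) (h ! i) * \<rho>)))"

definition det_success_prob ::
  "complex mat \<Rightarrow> nat \<Rightarrow> strategy \<Rightarrow> estimator \<Rightarrow> (nat \<Rightarrow> complex mat) \<Rightarrow> nat \<Rightarrow> real \<Rightarrow> real" where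
  "det_success_prob \<rho> T S est Obs M \<epsilon> =
     (\<Sum>h\<in>histories S T. hist_prob \<rho> S h *
        (if \<forall>x<M. \<bar>est h x - Re (mtrace (Obs x * \<rho>))\<bar> \<le> \<epsilon> then 1 else 0))"

(* A learning algorithm without quantum memory using T copies of an n-qubit state:
   internal classical randomness is modelled by a (finitely supported) probability
   distribution over deterministic (strategy, estimator) pairs. *)
type_synonym algorithm = "(strategy \<times> estimator) pmf"

definition valid_algorithm :: "nat \<Rightarrow> algorithm \<Rightarrow> bool" where
  "valid_algorithm n A \<longleftrightarrow> finite (set_pmf A) \<and> (\<forall>p\<in>set_pmf A. valid_strategy n (fst p))"

definition success_prob ::
  "complex mat \<Rightarrow> nat \<Rightarrow> algorithm \<Rightarrow> (nat \<Rightarrow> complex mat) \<Rightarrow> nat \<Rightarrow> real \<Rightarrow> real" where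
  "success_prob \<rho> T A Obs M \<epsilon> =
     measure_pmf.expectation A (\<lambda>(S, est). det_success_prob \<rho> T S est Obs M \<epsilon>)"

end

theory Submission
  imports Defs
begin

text \<open>Every round uses the same POVM, and the empirical mean of a single-copy unbiased estimator of
  \<open>Tr (O\<^sub>x \<rho>)\<close> is reported. If the estimator is bounded by \<open>2D\<close> with second moment at most \<open>4D\<close>,
  Bernstein's inequality and a union bound over \<open>x\<close> show that \<open>O(D log M / \<epsilon>\<^sup>2)\<close> rounds suffice.

  For \<open>D = M\<close>, measure a uniformly random \<open>O\<^sub>x\<close> through \<open>(I \<plusminus> O\<^sub>x) / 2\<close> and report \<open>\<plusminus>M\<close> for that \<open>x\<close>
  and \<open>0\<close> for the others.

  For \<open>D = d = 2\<^sup>n\<close>, no random unitaries are needed: the rank-one operators \<open>v v\<^sup>* / (8d)\<close> with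
  \<open>v = e\<^sub>i + c e\<^sub>j\<close>, \<open>c\<close> a fourth root of unity and \<open>i, j < d\<close> arbitrary (possibly equal), form a POVM,
  and \<open>2d Re (c O\<^sub>i\<^sub>j)\<close> is an unbiased estimator. Its second moment is
  \<open>2d \<Sum>\<^sub>i \<rho>\<^sub>i\<^sub>i \<parallel>O e\<^sub>i\<parallel>\<^sup>2 \<le> 2d\<close>.\<close>

subsection \<open>Positive semidefinite matrices\<close>

text \<open>The form inside \<open>psd_mat\<close>, but over an entry function instead of a matrix:
  elimination can then pass to leading blocks and Schur complements by changing \<open>d\<close> and
  \<open>a\<close> only.\<close>

definition quad_form :: "nat \<Rightarrow> (nat \<Rightarrow> nat \<Rightarrow> complex) \<Rightarrow> (nat \<Rightarrow> complex) \<Rightarrow> complex" where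
  "quad_form d a v = (\<Sum>i<d. \<Sum>j<d. cnj (v i) * a i j * v j)"

text \<open>Conjugation swaps the two summation indices, so the form equals its own conjugate.
  Positivity proofs therefore only have to treat the real part.\<close>

lemma quad_form_hermitian_real:
  assumes "\<And>i j. i < d \<Longrightarrow> j < d \<Longrightarrow> a i j = cnj (a j i)"
  shows "Im (quad_form d a v) = 0"
proof -
  have "cnj (quad_form d a v) = (\<Sum>i<d. \<Sum>j<d. v i * cnj (a i j) * cnj (v j))"
    by (simp add: quad_form_def)
  also have "\<dots> = (\<Sum>j<d. \<Sum>i<d. v i * cnj (a i j) * cnj (v j))"
    by (rule sum.swap)
  also have "\<dots> = quad_form d a v"
    unfolding quad_form_def
  proof (intro sum.cong refl)
    fix i j assume "i \<in> {..<d}" "j \<in> {..<d}"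
    then have "cnj (a j i) = a i j" using assms[of i j] by simp
    then show "v j * cnj (a j i) * cnj (v i) = cnj (v i) * a i j * v j" by simp
  qed
  finally show ?thesis
    by (simp add: complex_eq_iff)
qed

lemma quad_form_Suc:
  "quad_form (Suc d) a v = quad_form d a v + (\<Sum>i<d. cnj (v i) * a i d) * v d
     + cnj (v d) * (\<Sum>j<d. a d j * v j) + cnj (v d) * a d d * v d"
  by (simp add: quad_form_def sum.distrib sum_distrib_left sum_distrib_right mult_ac)

lemma quad_form_cong:
  assumes "\<And>i. i < d \<Longrightarrow> v i = w i"
  shows "quad_form d a v = quad_form d a w"
  using assms by (simp add: quad_form_def)

text \<open>The quadratic form of the rank-one matrix with entries \<open>b i * cnj (b j)\<close> is
  the squared modulus of an inner product. It serves both the Schur complement and the measurement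
  operators \<open>pair_proj\<close>.\<close>

lemma sum_cnj_mult_sum:
  "(\<Sum>i<(d::nat). \<Sum>j<d. cnj (v i) * (b i * cnj (b j)) * v j) = of_real ((cmod (\<Sum>j<d. cnj (b j) * v j))\<^sup>2)"
proof -
  have "of_real ((cmod (\<Sum>j<d. cnj (b j) * v j))\<^sup>2) = cnj (\<Sum>j<d. cnj (b j) * v j) * (\<Sum>j<d. cnj (b j) * v j)"
    by (metis complex_norm_square mult.commute)
  also have "\<dots> = (\<Sum>i<d. \<Sum>j<d. cnj (v i) * (b i * cnj (b j)) * v j)"
    by (simp add: sum_product mult_ac)
  finally show ?thesis by simp
qed

text \<open>Gaussian elimination: a positive pivot splits off a rank-one term, leaving a positive
  semidefinite Schur complement; a zero pivot forces its whole row to vanish.\<close>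

lemma psd_sum_rank_one:
  assumes "\<And>i j. i < d \<Longrightarrow> j < d \<Longrightarrow> a i j = cnj (a j i)"
    and "\<And>v. Re (quad_form d a v) \<ge> 0"
  shows "\<exists>V. \<forall>i<d. \<forall>j<d. a i j = (\<Sum>k<d. V k i * cnj (V k j))"
  using assms
proof (induction d arbitrary: a)
  case 0
  then show ?case by simp
next
  case (Suc d)
  note herm = Suc.prems(1) and pos = Suc.prems(2)
  have pivot_real: "a d d = of_real (Re (a d d))"
    using arg_cong[OF herm[of d d], of Im] by (simp add: complex_eq_iff)
  have row: "(\<Sum>i<d. cnj (v i) * a i d) = cnj (\<Sum>j<d. a d j * v j)" for v
  proof -
    have "cnj (v i) * a i d = cnj (a d i * v i)" if "i \<in> {..<d}" for i
      using herm[of i d] that by simp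
    then show ?thesis unfolding cnj_sum by (rule sum.cong[OF refl])
  qed
  \<comment> \<open>The form as a quadratic polynomial in the last coordinate \<open>t\<close>.
    Every inequality below comes from a choice of \<open>t\<close> in \<open>pos\<close>.\<close>
  have expand: "Re (quad_form (Suc d) a (v(d := t))) = Re (quad_form d a v)
      + 2 * Re (cnj t * (\<Sum>j<d. a d j * v j)) + (cmod t)\<^sup>2 * Re (a d d)" for v t
  proof -
    let ?w = "v(d := t)" and ?r = "\<Sum>j<d. a d j * v j"
    have "quad_form d a ?w = quad_form d a v"
      by (rule quad_form_cong) simp
    moreover have "(\<Sum>j<d. a d j * ?w j) = ?r"
      by (intro sum.cong) auto
    ultimately have "quad_form (Suc d) a ?w
        = quad_form d a v + cnj ?r * t + cnj t * ?r + cnj t * a d d * t"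
      unfolding quad_form_Suc row by simp
    moreover have "cnj t * a d d * t = of_real ((cmod t)\<^sup>2 * Re (a d d))"
      by (subst pivot_real) (metis complex_norm_square mult.commute mult.left_commute of_real_mult)
    ultimately have "quad_form (Suc d) a ?w
        = quad_form d a v + cnj ?r * t + cnj t * ?r + of_real ((cmod t)\<^sup>2 * Re (a d d))"
      by simp
    moreover have "Re (cnj ?r * t) = Re (cnj t * ?r)"
      by (metis complex_cnj_cnj complex_cnj_mult cnj.simps(1) mult.commute)
    ultimately show ?thesis
      by (simp only: plus_complex.simps Re_complex_of_real)
  qed
  have pivot_nonneg: "Re (a d d) \<ge> 0"
    using pos[of "(\<lambda>_. 0)(d := 1)"] unfolding expand by (simp add: quad_form_def)
  define \<alpha> where "\<alpha> = Re (a d d)"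
  \<comment> \<open>For a positive pivot this is column \<open>d\<close> divided by the root of the
    pivot, so that \<open>b i * cnj (b d)\<close> gives back \<open>a i d\<close>.\<close>
  define b where "b i = (if i < Suc d then a i d / of_real (sqrt \<alpha>) else 0)" for i
  have ex: "\<exists>b. (\<forall>i<Suc d. b i * cnj (b d) = a i d) \<and>
      (\<forall>v. Re (quad_form d (\<lambda>i j. a i j - b i * cnj (b j)) v) \<ge> 0)"
  proof (cases "\<alpha> = 0")
    case True
    have row0: "a d j = 0" if "j < d" for j
    proof (rule ccontr)
      assume nz: "a d j \<noteq> 0"
      define e where "e = (\<lambda>i. if i = j then 1 else 0 :: complex)"
      have s: "(\<Sum>i<d. a d i * e i) = a d j"
        using that by (simp add: e_def if_distrib[of "\<lambda>x. _ * x"] cong: if_cong)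
      define q where "q = Re (quad_form d a e)"
      \<comment> \<open>With pivot zero the form is affine along this direction of \<open>t\<close>;
        this \<open>c\<close> lowers it from \<open>q\<close> to exactly \<open>-1\<close>, a
        contradiction.\<close>
      define c where "c = (q + 1) / (2 * (cmod (a d j))\<^sup>2)"
      have "Re (cnj (- (of_real c * a d j)) * a d j) = - (c * (cmod (a d j))\<^sup>2)"
        by (simp add: cmod_def power2_eq_square algebra_simps)
      also have "\<dots> = - (q + 1) / 2"
        using nz by (simp add: c_def field_simps)
      finally have "Re (quad_form (Suc d) a (e(d := - (of_real c * a d j)))) = -1"
        unfolding expand s using True by (simp add: \<alpha>_def q_def)
      then show False
        using pos[of "e(d := - (of_real c * a d j))"] by simp
    qed
    have "a i d = 0" if "i < Suc d" for i
      using that row0 herm[of i d] True pivot_real by (cases "i = d") (auto simp: \<alpha>_def)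
    moreover have "Re (quad_form d a v) \<ge> 0" for v
      using pos[of "v(d := 0)"] unfolding expand by simp
    ultimately show ?thesis
      by (intro exI[of _ "\<lambda>_. 0"]) simp
  next
    case False
    then have \<alpha>: "\<alpha> > 0" using pivot_nonneg by (simp add: \<alpha>_def)
    have ss: "complex_of_real (sqrt \<alpha>) * of_real (sqrt \<alpha>) = of_real \<alpha>"
      using \<alpha> by (metis less_imp_le of_real_mult real_sqrt_mult_self abs_of_pos)
    have sn: "complex_of_real (sqrt \<alpha>) \<noteq> 0" using \<alpha> by simp
    have bd: "b d = of_real (sqrt \<alpha>)"
      using pivot_real sn ss by (simp add: b_def \<alpha>_def[symmetric] nonzero_divide_eq_eq)
    have "b i * cnj (b d) = a i d" if "i < Suc d" for i
      using that sn by (simp add: bd) (simp add: b_def)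
    moreover have "Re (quad_form d (\<lambda>i j. a i j - b i * cnj (b j)) v) \<ge> 0" for v
    proof -
      define r where "r = (\<Sum>j<d. a d j * v j)"
      have "cnj (b j) * v j = a d j * v j / of_real (sqrt \<alpha>)" if "j < d" for j
        using that herm[of d j] by (simp add: b_def)
      then have br: "(\<Sum>j<d. cnj (b j) * v j) = r / of_real (sqrt \<alpha>)"
        by (simp add: r_def sum_divide_distrib)
      have "quad_form d (\<lambda>i j. a i j - b i * cnj (b j)) v
          = quad_form d a v - of_real ((cmod (\<Sum>j<d. cnj (b j) * v j))\<^sup>2)"
        unfolding sum_cnj_mult_sum[symmetric]
        by (simp add: quad_form_def algebra_simps sum_subtractf)
      then have 1: "Re (quad_form d (\<lambda>i j. a i j - b i * cnj (b j)) v)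
          = Re (quad_form d a v) - (cmod r)\<^sup>2 / \<alpha>"
        using \<alpha> by (simp add: br norm_divide power_divide)
      \<comment> \<open>The minimiser of the quadratic in \<open>t\<close>; the minimum is exactly
        the value of the Schur complement at \<open>v\<close>.\<close>
      define t where "t = - (r / of_real \<alpha>)"
      have "Re (cnj t * r) = - (cmod r)\<^sup>2 / \<alpha>"
        using \<alpha> by (simp add: t_def cmod_def power2_eq_square field_simps)
      moreover have "(cmod t)\<^sup>2 * \<alpha> = (cmod r)\<^sup>2 / \<alpha>"
        using \<alpha> by (simp add: t_def norm_divide power2_eq_square)
      ultimately have "Re (quad_form (Suc d) a (v(d := t))) = Re (quad_form d a v) - (cmod r)\<^sup>2 / \<alpha>"
        unfolding expand r_def[symmetric] \<alpha>_def[symmetric] by simp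
      then show ?thesis using pos[of "v(d := t)"] 1 by linarith
    qed
    ultimately show ?thesis by blast
  qed
  then obtain b where b: "\<And>i. i < Suc d \<Longrightarrow> b i * cnj (b d) = a i d"
    and schur: "\<And>v. Re (quad_form d (\<lambda>i j. a i j - b i * cnj (b j)) v) \<ge> 0" by blast
  have "\<exists>V. \<forall>i<d. \<forall>j<d. a i j - b i * cnj (b j) = (\<Sum>k<d. V k i * cnj (V k j))"
  proof (rule Suc.IH)
    show "a i j - b i * cnj (b j) = cnj (a j i - b j * cnj (b i))" if "i < d" "j < d" for i j
      using herm[of i j] that by simp
  qed (rule schur)
  then obtain V where V: "\<And>i j. i < d \<Longrightarrow> j < d \<Longrightarrow> a i j - b i * cnj (b j) = (\<Sum>k<d. V k i * cnj (V k j))"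
    by blast
  \<comment> \<open>The vectors from the induction hypothesis are extended by zero in coordinate
    \<open>d\<close>, and \<open>b\<close> becomes the vector with index \<open>d\<close>. Entries
    in the last row or column then come from \<open>b\<close> alone.\<close>
  define W where "W k i = (if k < d then if i < d then V k i else 0 else b i)" for k i
  have "a i j = (\<Sum>k<Suc d. W k i * cnj (W k j))" if "i < Suc d" "j < Suc d" for i j
  proof (cases "i < d \<and> j < d")
    case True
    then show ?thesis using V[of i j] by (simp add: W_def algebra_simps)
  next
    case False
    then have "(\<Sum>k<d. W k i * cnj (W k j)) = 0"
      by (intro sum.neutral) (auto simp: W_def)
    moreover have "a i j = b i * cnj (b j)"
    proof (cases "j = d")
      case True
      then show ?thesis using b that by simp
    next
      case False
      then have "i = d" using \<open>\<not> (i < d \<and> j < d)\<close> that by simp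
      then show ?thesis
        using b[OF that(2)] herm[OF that] by (metis complex_cnj_cnj complex_cnj_mult mult.commute)
    qed
    ultimately show ?thesis by (simp add: W_def)
  qed
  then show ?case by blast
qed

section \<open>Entrywise rules for \<open>psd_mat\<close>, and positivity of the trace of a
  product\<close>

lemma psd_matI:
  assumes "A \<in> carrier_mat d d"
    and herm: "\<And>i j. i < d \<Longrightarrow> j < d \<Longrightarrow> A $$ (i,j) = cnj (A $$ (j,i))"
    and pos: "\<And>v. Re (quad_form d (\<lambda>i j. A $$ (i,j)) v) \<ge> 0"
  shows "psd_mat d A"
proof -
  have "Im (quad_form d (\<lambda>i j. A $$ (i,j)) v) = 0" for v
    using herm by (rule quad_form_hermitian_real)
  moreover have "hermitian_mat A"
    unfolding hermitian_mat_def using assms(1) herm carrier_matD[OF assms(1)]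
    by (metis square_mat.simps)
  ultimately show ?thesis
    using assms(1) pos by (simp add: psd_mat_def quad_form_def)
qed

lemma psd_matD:
  assumes "psd_mat d A"
  shows "A \<in> carrier_mat d d"
    and "i < d \<Longrightarrow> j < d \<Longrightarrow> A $$ (i,j) = cnj (A $$ (j,i))"
    and "Re (quad_form d (\<lambda>i j. A $$ (i,j)) v) \<ge> 0"
  using assms unfolding psd_mat_def hermitian_mat_def Let_def quad_form_def
  by (blast, metis carrier_matD(1), blast)

lemma mtrace_mult:
  assumes "A \<in> carrier_mat d d" "B \<in> carrier_mat d d"
  shows "mtrace (A * B) = (\<Sum>i<d. \<Sum>j<d. A $$ (i,j) * B $$ (j,i))"
  using assms by (auto simp: mtrace_def scalar_prod_def lessThan_atLeast0 intro!: sum.cong)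

text \<open>Writing \<open>B\<close> as a sum of rank-one terms turns the trace into a sum of values
  of the quadratic form of \<open>A\<close>. This makes outcome probabilities nonnegative.\<close>

lemma mtrace_mult_psd_nonneg:
  assumes "psd_mat d A" "psd_mat d B"
  shows "Re (mtrace (A * B)) \<ge> 0"
proof -
  have "\<exists>V. \<forall>i<d. \<forall>j<d. B $$ (i,j) = (\<Sum>k<d. V k i * cnj (V k j))"
    by (rule psd_sum_rank_one) (fact psd_matD[OF assms(2)])+
  then obtain V where V: "\<And>i j. i < d \<Longrightarrow> j < d \<Longrightarrow> B $$ (i,j) = (\<Sum>k<d. V k i * cnj (V k j))"
    by blast
  have "mtrace (A * B) = (\<Sum>i<d. \<Sum>j<d. \<Sum>k<d. cnj (V k i) * A $$ (i,j) * V k j)"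
    by (simp add: mtrace_mult[OF psd_matD(1)[OF assms(1)] psd_matD(1)[OF assms(2)]] V sum_distrib_left mult_ac)
  also have "\<dots> = (\<Sum>i<d. \<Sum>k<d. \<Sum>j<d. cnj (V k i) * A $$ (i,j) * V k j)"
    by (intro sum.cong refl sum.swap)
  also have "\<dots> = (\<Sum>k<d. \<Sum>i<d. \<Sum>j<d. cnj (V k i) * A $$ (i,j) * V k j)"
    by (rule sum.swap)
  also have "\<dots> = (\<Sum>k<d. quad_form d (\<lambda>i j. A $$ (i,j)) (V k))"
    by (simp add: quad_form_def)
  finally show ?thesis
    using psd_matD(3)[OF assms(1)] by (simp add: sum_nonneg)
qed

subsection \<open>Concentration for a repeated measurement\<close>

lemma exp_le_quadratic:
  fixes y :: real
  assumes "\<bar>y\<bar> \<le> 1"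
  shows "exp y \<le> 1 + y + y\<^sup>2"
proof (cases "y \<ge> 0")
  case True
  then show ?thesis using assms exp_bound[of y] by simp
next
  case False
  \<comment> \<open>For negative \<open>y\<close> it suffices that
    \<open>(1 - z + z^2) * exp z\<close> is at least 1; this follows by multiplying out against the
    quadratic Taylor bound for \<open>exp z\<close>.\<close>
  define z where "z = - y"
  have z: "0 \<le> z" using False by (simp add: z_def)
  have "1 + z + z\<^sup>2 / 2 \<le> exp z" using z by (rule exp_lower_Taylor_quadratic)
  moreover have "0 \<le> 1 - z + z\<^sup>2"
    using zero_le_power2[of "z - 1/2"] by (simp add: power2_eq_square algebra_simps)
  ultimately have "(1 - z + z\<^sup>2) * (1 + z + z\<^sup>2 / 2) \<le> (1 - z + z\<^sup>2) * exp z"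
    by (rule mult_left_mono)
  moreover have "(1 - z + z\<^sup>2) * (1 + z + z\<^sup>2 / 2) = 1 + (z\<^sup>2 + z^3 + z^4) / 2"
    by (simp add: power2_eq_square power3_eq_cube power4_eq_xxxx field_simps)
  moreover have "0 \<le> z\<^sup>2 + z^3 + z^4" using z by simp
  ultimately have "1 \<le> (1 - z + z\<^sup>2) * exp z"
    by (metis add_increasing2 divide_nonneg_nonneg order_refl order_trans zero_le_numeral)
  then have "1 / exp z \<le> 1 - z + z\<^sup>2" by (simp add: field_simps)
  then show ?thesis by (simp add: z_def exp_minus inverse_eq_divide)
qed

text \<open>Independence of the rounds as a sum identity. With \<open>g\<close> the outcome
  probabilities it gives total mass one, with exponentially tilted weights it gives the moment
  generating function of the sum.\<close>

lemma sum_lists_length_prod: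
  fixes g :: "nat \<Rightarrow> 'a :: comm_semiring_1"
  shows "(\<Sum>h | length h = T \<and> set h \<subseteq> {..<k}. prod_list (map g h)) = (\<Sum>s<k. g s) ^ T"
proof (induction T)
  case 0
  have "{h. length h = 0 \<and> set h \<subseteq> {..<k}} = {[]}" by auto
  then show ?case by simp
next
  case (Suc T)
  have "(\<Sum>h | length h = Suc T \<and> set h \<subseteq> {..<k}. prod_list (map g h))
      = (\<Sum>(s, h)\<in>{..<k} \<times> {h. length h = T \<and> set h \<subseteq> {..<k}}. g s * prod_list (map g h))"
    by (rule sum.reindex_bij_witness[of _ "\<lambda>(s, h). s # h" "\<lambda>h. (hd h, tl h)"])
      (auto simp: length_Suc_conv)
  also have "\<dots> = (\<Sum>s<k. g s) * (\<Sum>s<k. g s) ^ T"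
    by (simp add: sum.cartesian_product[symmetric] sum_product[symmetric] Suc.IH)
  finally show ?case by simp
qed

text \<open>Second-order expansion of the exponential, followed by \<open>1 + y \<le> exp y\<close>.
  The bound uses the raw second moment, so the estimator need not be centred.\<close>

lemma mgf_le:
  fixes p f :: "nat \<Rightarrow> real"
  assumes p: "\<And>s. s < k \<Longrightarrow> 0 \<le> p s" "(\<Sum>s<k. p s) = 1"
    and mean: "(\<Sum>s<k. p s * f s) = \<mu>"
    and var: "(\<Sum>s<k. p s * (f s)\<^sup>2) \<le> v"
    and bound: "\<And>s. s < k \<Longrightarrow> \<bar>l * f s\<bar> \<le> 1"
  shows "(\<Sum>s<k. p s * exp (l * f s)) \<le> exp (l * \<mu> + l\<^sup>2 * v)"
proof -
  have "(\<Sum>s<k. p s * exp (l * f s)) \<le> (\<Sum>s<k. p s * (1 + l * f s + (l * f s)\<^sup>2))"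
    by (intro sum_mono mult_left_mono exp_le_quadratic) (use p bound in auto)
  also have "\<dots> = (\<Sum>s<k. p s) + l * (\<Sum>s<k. p s * f s) + l\<^sup>2 * (\<Sum>s<k. p s * (f s)\<^sup>2)"
    by (simp add: sum.distrib sum_distrib_left algebra_simps power_mult_distrib)
  also have "\<dots> \<le> 1 + (l * \<mu> + l\<^sup>2 * v)"
    using var by (simp add: p mean mult_left_mono)
  also have "\<dots> \<le> exp (l * \<mu> + l\<^sup>2 * v)" by (rule exp_ge_add_one_self)
  finally show ?thesis .
qed

lemma prod_list_exp_sum_list:
  fixes p f :: "'a \<Rightarrow> real"
  shows "prod_list (map (\<lambda>s. p s * exp (l * f s)) h) = prod_list (map p h) * exp (l * sum_list (map f h))"
  by (induction h) (simp_all add: exp_add algebra_simps)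

text \<open>The weight \<open>exp (l * (S - T * \<mu>) - c)\<close>, with \<open>S\<close> the sum
  over the rounds, is at least 1 wherever \<open>l * (S - T * \<mu>) \<ge> c\<close>, so its mean
  bounds a tail probability. The mean factors into a power of the one-round moment generating
  function.\<close>

lemma chernoff_mass:
  fixes p f :: "nat \<Rightarrow> real"
  assumes "\<And>s. s < k \<Longrightarrow> 0 \<le> p s" "(\<Sum>s<k. p s) = 1"
    and "(\<Sum>s<k. p s * f s) = \<mu>"
    and "(\<Sum>s<k. p s * (f s)\<^sup>2) \<le> v"
    and "\<And>s. s < k \<Longrightarrow> \<bar>l * f s\<bar> \<le> 1"
  shows "(\<Sum>h | length h = T \<and> set h \<subseteq> {..<k}. prod_list (map p h) * exp (l * (sum_list (map f h) - T * \<mu>) - c))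
    \<le> exp (T * (l\<^sup>2 * v) - c)"
proof -
  have "(\<Sum>h | length h = T \<and> set h \<subseteq> {..<k}. prod_list (map p h) * exp (l * (sum_list (map f h) - T * \<mu>) - c))
      = (\<Sum>h | length h = T \<and> set h \<subseteq> {..<k}.
          prod_list (map (\<lambda>s. p s * exp (l * f s)) h)) * exp (- (T * (l * \<mu>)) - c)"
    unfolding prod_list_exp_sum_list sum_distrib_right
    by (intro sum.cong refl) (simp add: mult.assoc exp_add[symmetric] algebra_simps)
  also have "\<dots> = (\<Sum>s<k. p s * exp (l * f s)) ^ T * exp (- (T * (l * \<mu>)) - c)"
    by (simp only: sum_lists_length_prod)
  also have "\<dots> \<le> exp (l * \<mu> + l\<^sup>2 * v) ^ T * exp (- (T * (l * \<mu>)) - c)"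
    by (intro mult_right_mono power_mono mgf_le sum_nonneg) (use assms in auto)
  also have "\<dots> = exp (T * (l\<^sup>2 * v) - c)"
    by (simp add: exp_of_nat_mult[symmetric] exp_add[symmetric] algebra_simps)
  finally show ?thesis .
qed

section \<open>Outcome statistics when every round uses the same POVM\<close>

lemma histories_const:
  "histories (\<lambda>_. (k, F)) T = {h. length h = T \<and> set h \<subseteq> {..<k}}"
  by (auto simp: histories_def in_set_conv_nth subset_iff)

lemma hist_prob_const:
  "hist_prob \<rho> (\<lambda>_. (k, F)) h = prod_list (map (\<lambda>s. Re (mtrace (F s * \<rho>))) h)"
  by (simp add: hist_prob_def prod.list_conv_set_nth lessThan_atLeast0)

text \<open>Nonnegativity is trace positivity; the total mass is \<open>mtrace \<rho>\<close>
  because the POVM elements add up to the identity entrywise.\<close>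

lemma state_outcome_distribution:
  assumes "is_povm n (k, F)" "is_state n \<rho>"
  shows "s < k \<Longrightarrow> 0 \<le> Re (mtrace (F s * \<rho>))"
    and "(\<Sum>s<k. Re (mtrace (F s * \<rho>))) = 1"
proof -
  let ?d = "2 ^ n :: nat"
  have psd: "psd_mat ?d (F s)" if "s < k" for s using assms(1) that by (auto simp: is_povm_def)
  have \<rho>: "psd_mat ?d \<rho>" "mtrace \<rho> = 1" using assms(2) by (auto simp: is_state_def)
  show "s < k \<Longrightarrow> 0 \<le> Re (mtrace (F s * \<rho>))"
    using mtrace_mult_psd_nonneg[OF psd \<rho>(1)] by simp
  have "(\<Sum>s<k. mtrace (F s * \<rho>)) = (\<Sum>s<k. \<Sum>i<?d. \<Sum>j<?d. F s $$ (i,j) * \<rho> $$ (j,i))"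
    using psd \<rho>(1) by (intro sum.cong refl mtrace_mult) (auto dest: psd_matD(1))
  also have "\<dots> = (\<Sum>i<?d. \<Sum>s<k. \<Sum>j<?d. F s $$ (i,j) * \<rho> $$ (j,i))"
    by (rule sum.swap)
  also have "\<dots> = (\<Sum>i<?d. \<Sum>j<?d. \<Sum>s<k. F s $$ (i,j) * \<rho> $$ (j,i))"
    by (intro sum.cong refl sum.swap)
  also have "\<dots> = (\<Sum>i<?d. \<Sum>j<?d. (if i = j then 1 else 0) * \<rho> $$ (j,i))"
    using assms(1) by (intro sum.cong refl) (simp add: sum_distrib_right[symmetric] is_povm_def)
  also have "\<dots> = (\<Sum>i<?d. \<rho> $$ (i,i))"
    by (intro sum.cong refl) (simp add: if_distrib[of "\<lambda>x. x * _"] cong: if_cong)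
  also have "\<dots> = 1"
    using \<rho> psd_matD(1)[OF \<rho>(1)] by (simp add: mtrace_def)
  finally show "(\<Sum>s<k. Re (mtrace (F s * \<rho>))) = 1"
    by (simp flip: Re_sum)
qed

text \<open>Each of the \<open>M\<close> observables can fail upwards or downwards; a Chernoff bound
  for each of these events and a union bound give the factor \<open>2 * M\<close>.\<close>

lemma success_prob_const_ge:
  fixes f :: "nat \<Rightarrow> nat \<Rightarrow> real"
  assumes povm: "is_povm n (k, F)" and state: "is_state n \<rho>"
    and mean: "\<And>x. x < M \<Longrightarrow> (\<Sum>s<k. Re (mtrace (F s * \<rho>)) * f x s) = Re (mtrace (Obs x * \<rho>))"
    and var: "\<And>x. x < M \<Longrightarrow> (\<Sum>s<k. Re (mtrace (F s * \<rho>)) * (f x s)\<^sup>2) \<le> 4 * D"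
    and bound: "\<And>x s. x < M \<Longrightarrow> s < k \<Longrightarrow> \<bar>f x s\<bar> \<le> 2 * D"
    and D: "D \<ge> 1" and \<epsilon>: "0 < \<epsilon>" "\<epsilon> \<le> 1" and T: "T > 0"
  shows "success_prob \<rho> T (return_pmf (\<lambda>_. (k, F), \<lambda>h x. sum_list (map (f x) h) / T)) Obs M \<epsilon>
    \<ge> 1 - 2 * real M * exp (- (T * \<epsilon>\<^sup>2 / (16 * D)))"
proof -
  define p where "p s = Re (mtrace (F s * \<rho>))" for s
  define \<mu> where "\<mu> x = Re (mtrace (Obs x * \<rho>))" for x
  define H where "H = {h. length h = T \<and> set h \<subseteq> {..<k}}"
  define P where "P h = prod_list (map p h)" for h
  \<comment> \<open>Minimises the exponent per round, \<open>4 * D * l^2 - l * \<epsilon>\<close>,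
    with minimum \<open>- \<epsilon>^2 / (16 * D)\<close>. It also keeps \<open>l * f\<close> within
    \<open>[-1, 1]\<close>, as \<open>\<epsilon> \<le> 1\<close>.\<close>
  define l where "l = \<epsilon> / (8 * D)"
  define c where "c = l * (T * \<epsilon>)"
  define X where "X x h = sum_list (map (f x) h) - T * \<mu> x" for x h
  define good where "good h \<longleftrightarrow> (\<forall>x<M. \<bar>sum_list (map (f x) h) / T - \<mu> x\<bar> \<le> \<epsilon>)" for h
  note p = state_outcome_distribution[OF povm state, folded p_def]
  have l: "l > 0" using D \<epsilon> by (simp add: l_def)
  have P0: "P h \<ge> 0" if "h \<in> H" for h
    unfolding P_def by (rule prod_list_nonneg) (use that p(1) in \<open>auto simp: H_def\<close>)
  have lf: "\<bar>l * f x s\<bar> \<le> 1" if "x < M" "s < k" for x s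
  proof -
    have "\<bar>l * f x s\<bar> \<le> l * (2 * D)" using bound[OF that] l by (simp add: abs_mult)
    also have "\<dots> \<le> 1" using D \<epsilon> by (simp add: l_def)
    finally show ?thesis .
  qed
  have expo: "T * (l\<^sup>2 * (4 * D)) - c = - (T * \<epsilon>\<^sup>2 / (16 * D))"
    using D by (simp add: l_def c_def power2_eq_square field_simps)
  have up: "(\<Sum>h\<in>H. P h * exp (l * X x h - c)) \<le> exp (- (T * \<epsilon>\<^sup>2 / (16 * D)))" if "x < M" for x
    unfolding H_def P_def X_def expo[symmetric]
    by (rule chernoff_mass) (use p mean[OF that] var[OF that] lf[OF that] in \<open>auto simp: p_def \<mu>_def\<close>)
  \<comment> \<open>The lower tail is the same bound at \<open>-l\<close>; the right-hand side
    depends on \<open>l\<close> only through its square.\<close>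
  have lo: "(\<Sum>h\<in>H. P h * exp (- l * X x h - c)) \<le> exp (- (T * \<epsilon>\<^sup>2 / (16 * D)))" if "x < M" for x
    unfolding H_def P_def X_def expo[symmetric] power2_minus[of l, symmetric]
    by (rule chernoff_mass) (use p mean[OF that] var[OF that] lf[OF that] in \<open>auto simp: p_def \<mu>_def\<close>)
  \<comment> \<open>The union bound, pointwise in the history: on a bad history one of the
    \<open>2 * M\<close> exponents is nonnegative, so the left side is at most 0.\<close>
  have tail: "1 - (\<Sum>x<M. exp (l * X x h - c) + exp (- l * X x h - c)) \<le> (if good h then 1 else 0)" for h
  proof (cases "good h")
    case True
    then show ?thesis by (auto intro!: sum_nonneg add_nonneg_nonneg)
  next
    case False
    then obtain x where x: "x < M" "\<bar>sum_list (map (f x) h) / T - \<mu> x\<bar> > \<epsilon>"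
      by (auto simp: good_def not_le)
    have "sum_list (map (f x) h) / T - \<mu> x = X x h / T"
      using T by (simp add: X_def field_simps)
    then have "\<bar>X x h\<bar> > T * \<epsilon>" using x(2) T by (simp add: field_simps)
    then have "l * \<bar>X x h\<bar> \<ge> c" using l by (simp add: c_def)
    then have "0 \<le> l * X x h - c \<or> 0 \<le> - l * X x h - c"
      by (cases "X x h \<ge> 0") (auto simp: abs_if)
    then have "1 \<le> exp (l * X x h - c) + exp (- l * X x h - c)"
      by (smt (verit) exp_ge_zero one_le_exp_iff)
    also have "\<dots> \<le> (\<Sum>x<M. exp (l * X x h - c) + exp (- l * X x h - c))"
      using x(1) by (intro member_le_sum) (auto intro!: add_nonneg_nonneg)
    finally show ?thesis using False by simp
  qed
  have "1 - 2 * real M * exp (- (T * \<epsilon>\<^sup>2 / (16 * D)))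
      = 1 - (\<Sum>x<M. exp (- (T * \<epsilon>\<^sup>2 / (16 * D))) + exp (- (T * \<epsilon>\<^sup>2 / (16 * D))))"
    by simp
  also have "\<dots> \<le> 1 - (\<Sum>x<M. (\<Sum>h\<in>H. P h * exp (l * X x h - c)) + (\<Sum>h\<in>H. P h * exp (- l * X x h - c)))"
    using up lo by (intro diff_left_mono sum_mono add_mono) auto
  also have "\<dots> = (\<Sum>h\<in>H. P h) - (\<Sum>x<M. \<Sum>h\<in>H. P h * (exp (l * X x h - c) + exp (- l * X x h - c)))"
    using sum_lists_length_prod[where g = p and T = T and k = k] p(2)
    by (simp add: H_def P_def distrib_left sum.distrib)
  also have "\<dots> = (\<Sum>h\<in>H. P h * (1 - (\<Sum>x<M. exp (l * X x h - c) + exp (- l * X x h - c))))"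
    by (subst sum.swap) (simp add: right_diff_distrib sum_subtractf sum_distrib_left)
  also have "\<dots> \<le> (\<Sum>h\<in>H. P h * (if good h then 1 else 0))"
    by (intro sum_mono mult_left_mono tail P0)
  also have "\<dots> = success_prob \<rho> T (return_pmf (\<lambda>_. (k, F), \<lambda>h x. sum_list (map (f x) h) / T)) Obs M \<epsilon>"
    by (simp add: success_prob_def det_success_prob_def histories_const hist_prob_const
        H_def P_def p_def[abs_def] good_def \<mu>_def)
  finally show ?thesis .
qed

text \<open>Reduces learning to one POVM with an unbiased estimator of controlled size and second
  moment. Outcomes range over any finite set, so that they can be indexed by tuples; an enumeration
  moves them to \<open>{..<k}\<close>. As \<open>f\<close> does not depend on the state, one
  algorithm serves all states.\<close>

lemma learnable_from_single_copy_estimator: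
  fixes I :: "'a set" and F :: "'a \<Rightarrow> complex mat" and f :: "nat \<Rightarrow> 'a \<Rightarrow> real"
  assumes fin: "finite I" and psd: "\<And>s. s \<in> I \<Longrightarrow> psd_mat (2 ^ n) (F s)"
    and total: "\<And>i j. i < 2 ^ n \<Longrightarrow> j < 2 ^ n \<Longrightarrow> (\<Sum>s\<in>I. F s $$ (i,j)) = (if i = j then 1 else 0)"
    and mean: "\<And>\<rho> x. is_state n \<rho> \<Longrightarrow> x < M \<Longrightarrow>
      (\<Sum>s\<in>I. Re (mtrace (F s * \<rho>)) * f x s) = Re (mtrace (Obs x * \<rho>))"
    and var: "\<And>\<rho> x. is_state n \<rho> \<Longrightarrow> x < M \<Longrightarrow>
      (\<Sum>s\<in>I. Re (mtrace (F s * \<rho>)) * (f x s)\<^sup>2) \<le> 4 * D"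
    and bound: "\<And>x s. x < M \<Longrightarrow> s \<in> I \<Longrightarrow> \<bar>f x s\<bar> \<le> 2 * D"
    and D: "D \<ge> 1" and M: "M > 0" and \<epsilon>: "0 < \<epsilon>" "\<epsilon> \<le> 1"
  shows "\<exists>(T::nat) (A::algorithm). real T \<le> 146 * (D * ln (real M + 1)) / \<epsilon>\<^sup>2 \<and> valid_algorithm n A \<and>
    (\<forall>\<rho>. is_state n \<rho> \<longrightarrow> success_prob \<rho> T A Obs M \<epsilon> \<ge> 0.99)"
proof -
  obtain e where e: "bij_betw e {..<card I} I"
    using ex_bij_betw_nat_finite[OF fin] by (auto simp: lessThan_atLeast0)
  define k where "k = card I"
  note e = e[folded k_def]
  have reindex: "(\<Sum>s<k. g (e s)) = (\<Sum>s\<in>I. g s)" for g :: "'a \<Rightarrow> 'b :: comm_monoid_add"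
    using sum.reindex_bij_betw[OF e] .
  have eI: "e s \<in> I" if "s < k" for s using bij_betwE[OF e] that by auto
  have povm: "is_povm n (k, \<lambda>s. F (e s))"
    using psd eI total reindex[of "\<lambda>s. F s $$ (_, _)"] by (auto simp: is_povm_def)
  define L where "L = D * ln (real M + 1) / \<epsilon>\<^sup>2"
  \<comment> \<open>Since \<open>144 = 9 * 16\<close>, the failure bound becomes
    \<open>2 * M / (M + 1)^9\<close>, which is at most \<open>2 / 256\<close> for
    \<open>M \<ge> 1\<close>.\<close>
  define T where "T = nat \<lceil>144 * L\<rceil>"
  define A where "A = return_pmf (\<lambda>_ :: nat list. (k, \<lambda>s. F (e s)), \<lambda>h x. sum_list (map (\<lambda>s. f x (e s)) h) / T)"
  \<comment> \<open>The \<open>+ 1\<close> keeps the logarithm away from zero already at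
    \<open>M = 1\<close>.\<close>
  have ln: "ln (real M + 1) \<ge> 1 / 2"
  proof -
    have "1 / 2 \<le> ln (2::real)" using ln2_ge_two_thirds by simp
    also have "\<dots> \<le> ln (real M + 1)" using M by simp
    finally show ?thesis .
  qed
  have "\<epsilon>\<^sup>2 \<le> 1" using \<epsilon> by (simp add: power_le_one)
  moreover have "1 / 2 \<le> D * ln (real M + 1)"
    using mult_mono[OF D ln] D by simp
  ultimately have L: "L \<ge> 1 / 2"
    unfolding L_def using \<epsilon> by (simp add: pos_le_divide_eq)
  have T_ge: "144 * L \<le> T" unfolding T_def by linarith
  \<comment> \<open>Rounding up costs at most 1, and \<open>1 \<le> 2 * L\<close>; hence
    146.\<close>
  have T_le: "T \<le> 146 * L" unfolding T_def using L by linarith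
  have T0: "T > 0" using T_ge L by linarith
  have ex: "2 * real M * exp (- (T * \<epsilon>\<^sup>2 / (16 * D))) \<le> 0.01"
  proof -
    have "9 * ln (real M + 1) = 144 * L * \<epsilon>\<^sup>2 / (16 * D)"
      using D \<epsilon> by (simp add: L_def)
    also have "\<dots> \<le> T * \<epsilon>\<^sup>2 / (16 * D)"
      using T_ge D by (intro divide_right_mono mult_right_mono) auto
    finally have "exp (- (T * \<epsilon>\<^sup>2 / (16 * D))) \<le> exp (- (9 * ln (real M + 1)))" by simp
    also have "\<dots> = inverse (exp (ln (real M + 1)) ^ 9)"
      by (simp only: exp_minus exp_of_nat_mult[symmetric] of_nat_numeral)
    also have "\<dots> = 1 / (real M + 1) ^ 9"
      by (simp add: inverse_eq_divide)
    finally have 1: "exp (- (T * \<epsilon>\<^sup>2 / (16 * D))) \<le> 1 / (real M + 1) ^ 9" .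
    have "(2::real) ^ 8 \<le> (real M + 1) ^ 8" using M by (intro power_mono) auto
    then have "256 * (real M + 1) \<le> (real M + 1) ^ 8 * (real M + 1)"
      by (intro mult_right_mono) auto
    then have 2: "200 * real M \<le> (real M + 1) ^ 9"
      by (simp add: power_Suc2[of _ 8, simplified])
    have "2 * real M * exp (- (T * \<epsilon>\<^sup>2 / (16 * D))) \<le> 2 * real M * (1 / (real M + 1) ^ 9)"
      using 1 by (intro mult_left_mono) auto
    also have "\<dots> \<le> 0.01" using 2 by (simp add: field_simps)
    finally show ?thesis .
  qed
  have "success_prob \<rho> T A Obs M \<epsilon> \<ge> 0.99" if \<rho>: "is_state n \<rho>" for \<rho>
  proof -
    have "success_prob \<rho> T A Obs M \<epsilon> \<ge> 1 - 2 * real M * exp (- (T * \<epsilon>\<^sup>2 / (16 * D)))"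
      unfolding A_def
    proof (rule success_prob_const_ge[OF povm \<rho>])
      fix x assume x: "x < M"
      show "(\<Sum>s<k. Re (mtrace (F (e s) * \<rho>)) * f x (e s)) = Re (mtrace (Obs x * \<rho>))"
        using mean[OF \<rho> x] reindex[of "\<lambda>s. Re (mtrace (F s * \<rho>)) * f x s"] by simp
      show "(\<Sum>s<k. Re (mtrace (F (e s) * \<rho>)) * (f x (e s))\<^sup>2) \<le> 4 * D"
        using var[OF \<rho> x] reindex[of "\<lambda>s. Re (mtrace (F s * \<rho>)) * (f x s)\<^sup>2"] by simp
    qed (use bound eI D \<epsilon> T0 in auto)
    then show ?thesis using ex by simp
  qed
  moreover have "valid_algorithm n A"
    using povm by (simp add: valid_algorithm_def valid_strategy_def A_def)
  moreover have "real T \<le> 146 * (D * ln (real M + 1)) / \<epsilon>\<^sup>2"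
    using T_le by (simp add: L_def)
  ultimately show ?thesis by blast
qed

subsection \<open>Contractions and random observables\<close>

text \<open>By homogeneity the bound for unit vectors, which \<open>op_norm\<close> provides,
  extends to all vectors.\<close>

lemma contraction_norm_le:
  assumes A: "A \<in> carrier_mat d d" and norm: "op_norm A \<le> 1"
  shows "(\<Sum>i<d. (cmod (\<Sum>j<d. A $$ (i,j) * v j))\<^sup>2) \<le> (\<Sum>i<d. (cmod (v i))\<^sup>2)"
proof (cases "cvec_norm d v = 0")
  case True
  then have "(\<Sum>i<d. (cmod (v i))\<^sup>2) = 0" by (simp add: cvec_norm_def)
  then have "\<forall>i<d. v i = 0" by (subst (asm) sum_nonneg_eq_0_iff) auto
  then show ?thesis by (simp add: sum_nonneg)
next
  case False
  let ?S = "{cvec_norm d (\<lambda>i. \<Sum>j<d. A $$ (i,j) * w j) | w. cvec_norm d w = 1}"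
  \<comment> \<open>A real \<open>Sup\<close> dominates its set only if the set is bounded.
    Coordinates of a unit vector have modulus at most 1, so absolute row sums give a crude
    bound.\<close>
  have "bdd_above ?S"
  proof (rule bdd_aboveI)
    fix y assume "y \<in> ?S"
    then obtain w where w: "cvec_norm d w = 1" and y: "y = cvec_norm d (\<lambda>i. \<Sum>j<d. A $$ (i,j) * w j)"
      by blast
    have "cmod (w j) \<le> 1" if "j < d" for j
    proof -
      have "(cmod (w j))\<^sup>2 \<le> (\<Sum>i<d. (cmod (w i))\<^sup>2)"
        using that by (intro member_le_sum) auto
      also have "\<dots> = 1" using w by (simp add: cvec_norm_def)
      finally show ?thesis by (simp add: abs_square_le_1)
    qed
    then have "cmod (\<Sum>j<d. A $$ (i,j) * w j) \<le> (\<Sum>j<d. cmod (A $$ (i,j)))" for i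
      by (intro order.trans[OF norm_sum] sum_mono) (auto simp: norm_mult intro: mult_left_le)
    then show "y \<le> sqrt (\<Sum>i<d. (\<Sum>j<d. cmod (A $$ (i,j)))\<^sup>2)"
      unfolding y cvec_norm_def by (intro real_sqrt_le_mono sum_mono power_mono) auto
  qed
  define N where "N = cvec_norm d v"
  have N2: "N\<^sup>2 = (\<Sum>i<d. (cmod (v i))\<^sup>2)" by (simp add: N_def cvec_norm_def sum_nonneg)
  have N: "N > 0" using False by (simp add: N_def cvec_norm_def sum_nonneg less_le)
  define w where "w i = v i / of_real N" for i
  have "(\<Sum>i<d. (cmod (w i))\<^sup>2) = 1"
    using N by (simp add: w_def norm_divide power_divide sum_divide_distrib[symmetric] N2[symmetric])
  then have "cvec_norm d w = 1" by (simp add: cvec_norm_def)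
  then have "cvec_norm d (\<lambda>i. \<Sum>j<d. A $$ (i,j) * w j) \<in> ?S" by blast
  then have "cvec_norm d (\<lambda>i. \<Sum>j<d. A $$ (i,j) * w j) \<le> Sup ?S"
    using \<open>bdd_above ?S\<close> by (rule cSup_upper)
  also have "\<dots> \<le> 1" using norm A by (simp add: op_norm_def)
  finally have "(\<Sum>i<d. (cmod (\<Sum>j<d. A $$ (i,j) * w j))\<^sup>2) \<le> 1"
    by (simp add: cvec_norm_def)
  moreover have "(\<Sum>j<d. A $$ (i,j) * w j) = (\<Sum>j<d. A $$ (i,j) * v j) / of_real N" for i
    by (simp add: w_def sum_divide_distrib)
  ultimately show ?thesis
    using N by (simp add: norm_divide power_divide sum_divide_distrib[symmetric] N2[symmetric])
qed

text \<open>The contraction applied to a basis vector. This column bound keeps the second moment of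
  the interference estimator linear in the dimension; a bound on single entries would lose a further
  factor \<open>d\<close>.\<close>

lemma contraction_column_le:
  assumes "A \<in> carrier_mat d d" "op_norm A \<le> 1" "j < d"
  shows "(\<Sum>i<d. (cmod (A $$ (i,j)))\<^sup>2) \<le> 1"
  using contraction_norm_le[OF assms(1,2), of "\<lambda>i. of_bool (i = j)"] assms(3)
  by (simp add: of_bool_def if_distrib[of "\<lambda>x. _ * x"] if_distrib[of "\<lambda>x. cmod x ^ 2"] cong: if_cong)

lemma contraction_entry_le:
  assumes "A \<in> carrier_mat d d" "op_norm A \<le> 1" "i < d" "j < d"
  shows "cmod (A $$ (i,j)) \<le> 1"
proof -
  have "(cmod (A $$ (i,j)))\<^sup>2 \<le> (\<Sum>i<d. (cmod (A $$ (i,j)))\<^sup>2)"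
    using assms(3) by (intro member_le_sum) auto
  also have "\<dots> \<le> 1" using assms by (intro contraction_column_le)
  finally show ?thesis by (simp add: abs_square_le_1)
qed

text \<open>Expand the squared norm of \<open>v + \<sigma> A v\<close> and bound the norm of
  \<open>A v\<close> by that of \<open>v\<close>: the result is twice the right-hand side. Thus the
  form of \<open>I + \<sigma> A\<close> is nonnegative without any spectral decomposition.\<close>

lemma contraction_quad_form_ge:
  assumes "A \<in> carrier_mat d d" "op_norm A \<le> 1" and \<sigma>: "\<sigma>\<^sup>2 = (1 :: real)"
  shows "0 \<le> (\<Sum>i<d. (cmod (v i))\<^sup>2) + \<sigma> * Re (quad_form d (\<lambda>i j. A $$ (i,j)) v)"
proof -
  define u where "u i = (\<Sum>j<d. A $$ (i,j) * v j)" for i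
  have q: "quad_form d (\<lambda>i j. A $$ (i,j)) v = (\<Sum>i<d. cnj (v i) * u i)"
    by (simp add: quad_form_def u_def sum_distrib_left mult.assoc)
  have sq: "(cmod (v i + of_real \<sigma> * u i))\<^sup>2
      = (cmod (v i))\<^sup>2 + (cmod (u i))\<^sup>2 + 2 * (\<sigma> * Re (cnj (v i) * u i))" for i
  proof -
    have "(cmod (v i + of_real \<sigma> * u i))\<^sup>2
        = (cmod (v i))\<^sup>2 + \<sigma>\<^sup>2 * (cmod (u i))\<^sup>2 + 2 * (\<sigma> * Re (cnj (v i) * u i))"
      unfolding cmod_power2 by (simp add: power2_eq_square algebra_simps)
    then show ?thesis using \<sigma> by simp
  qed
  have "0 \<le> (\<Sum>i<d. (cmod (v i + of_real \<sigma> * u i))\<^sup>2)" by (simp add: sum_nonneg)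
  also have "\<dots> = (\<Sum>i<d. (cmod (v i))\<^sup>2) + (\<Sum>i<d. (cmod (u i))\<^sup>2)
      + 2 * (\<sigma> * Re (quad_form d (\<lambda>i j. A $$ (i,j)) v))"
    unfolding sq q by (simp only: sum.distrib sum_distrib_left Re_sum)
  finally show ?thesis
    using contraction_norm_le[OF assms(1,2), of v] by (simp add: u_def)
qed

text \<open>With \<open>w = 1 / (2 * M)\<close> and \<open>\<sigma> = \<plusminus>1\<close> these
  are the POVM elements for measuring an observable picked with probability \<open>1 / M\<close>;
  \<open>w = 1\<close> serves to bound expectation values.\<close>

definition shifted_obs :: "nat \<Rightarrow> real \<Rightarrow> real \<Rightarrow> complex mat \<Rightarrow> complex mat" where
  "shifted_obs d w \<sigma> A = Matrix.mat d d (\<lambda>(i,j). of_real w * (of_bool (i = j) + of_real \<sigma> * A $$ (i,j)))"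

lemma hermitian_matD:
  assumes "hermitian_mat A" "A \<in> carrier_mat d d" "i < d" "j < d"
  shows "A $$ (i,j) = cnj (A $$ (j,i))"
  using assms unfolding hermitian_mat_def by (metis carrier_matD(1))

lemma psd_shifted_obs:
  assumes A: "A \<in> carrier_mat d d" "hermitian_mat A" "op_norm A \<le> 1" and \<sigma>: "\<sigma>\<^sup>2 = 1" and w: "w \<ge> 0"
  shows "psd_mat d (shifted_obs d w \<sigma> A)"
proof (rule psd_matI)
  show "shifted_obs d w \<sigma> A $$ (i,j) = cnj (shifted_obs d w \<sigma> A $$ (j,i))" if "i < d" "j < d" for i j
    using that hermitian_matD[OF A(2,1) that] by (auto simp: shifted_obs_def)
  fix v
  have delta: "(\<Sum>i<d. \<Sum>j<d. cnj (v i) * of_bool (i = j) * v j) = (\<Sum>i<d. of_real ((cmod (v i))\<^sup>2))"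
  proof (intro sum.cong refl)
    fix i assume "i \<in> {..<d}"
    then have "(\<Sum>j<d. cnj (v i) * of_bool (i = j) * v j) = cnj (v i) * v i"
      by (simp add: of_bool_def if_distrib[of "\<lambda>x. _ * x"] if_distrib[of "\<lambda>x. x * _"] cong: if_cong)
    also have "\<dots> = of_real ((cmod (v i))\<^sup>2)" by (metis complex_norm_square mult.commute)
    finally show "(\<Sum>j<d. cnj (v i) * of_bool (i = j) * v j) = of_real ((cmod (v i))\<^sup>2)" .
  qed
  have "quad_form d (\<lambda>i j. shifted_obs d w \<sigma> A $$ (i,j)) v
      = (\<Sum>i<d. \<Sum>j<d. of_real w * (cnj (v i) * of_bool (i = j) * v j
          + of_real \<sigma> * (cnj (v i) * A $$ (i,j) * v j)))"
    unfolding quad_form_def by (intro sum.cong refl) (simp add: shifted_obs_def algebra_simps)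
  also have "\<dots> = of_real w * ((\<Sum>i<d. \<Sum>j<d. cnj (v i) * of_bool (i = j) * v j)
      + of_real \<sigma> * quad_form d (\<lambda>i j. A $$ (i,j)) v)"
    unfolding quad_form_def by (simp only: sum_distrib_left[symmetric] sum.distrib)
  also have "Re \<dots> = w * ((\<Sum>i<d. (cmod (v i))\<^sup>2) + \<sigma> * Re (quad_form d (\<lambda>i j. A $$ (i,j)) v))"
    unfolding delta by simp
  finally show "0 \<le> Re (quad_form d (\<lambda>i j. shifted_obs d w \<sigma> A $$ (i,j)) v)"
    using contraction_quad_form_ge[OF A(1,3) \<sigma>, of v] w by simp
qed (simp add: shifted_obs_def)

lemma mtrace_shifted_obs:
  assumes "A \<in> carrier_mat d d" "\<rho> \<in> carrier_mat d d" "mtrace \<rho> = 1"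
  shows "Re (mtrace (shifted_obs d w \<sigma> A * \<rho>)) = w * (1 + \<sigma> * Re (mtrace (A * \<rho>)))"
proof -
  have "mtrace (shifted_obs d w \<sigma> A * \<rho>) = (\<Sum>i<d. \<Sum>j<d. shifted_obs d w \<sigma> A $$ (i,j) * \<rho> $$ (j,i))"
    using assms(2) by (intro mtrace_mult) (simp_all add: shifted_obs_def)
  also have "\<dots> = (\<Sum>i<d. \<Sum>j<d. of_real w * (of_bool (i = j) * \<rho> $$ (j,i)
      + of_real \<sigma> * (A $$ (i,j) * \<rho> $$ (j,i))))"
    by (intro sum.cong refl) (simp add: shifted_obs_def algebra_simps)
  also have "\<dots> = of_real w * ((\<Sum>i<d. \<Sum>j<d. of_bool (i = j) * \<rho> $$ (j,i)) + of_real \<sigma> * mtrace (A * \<rho>))"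
    unfolding mtrace_mult[OF assms(1,2)] by (simp only: sum_distrib_left[symmetric] sum.distrib)
  also have "(\<Sum>i<d. \<Sum>j<d. of_bool (i = j) * \<rho> $$ (j,i)) = mtrace \<rho>"
    using assms(2) by (simp add: mtrace_def of_bool_def if_distrib[of "\<lambda>x. x * _"] cong: if_cong)
  finally show ?thesis using assms(3) by simp
qed

text \<open>Both \<open>I + A\<close> and \<open>I - A\<close> have nonnegative trace against the
  state. For \<open>\<epsilon> \<ge> 1\<close> this makes the constant estimate 0 accurate
  enough.\<close>

lemma abs_expectation_le_one:
  assumes A: "A \<in> carrier_mat d d" "hermitian_mat A" "op_norm A \<le> 1"
    and \<rho>: "psd_mat d \<rho>" "mtrace \<rho> = 1"
  shows "\<bar>Re (mtrace (A * \<rho>))\<bar> \<le> 1"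
proof -
  have "0 \<le> 1 + \<sigma> * Re (mtrace (A * \<rho>))" if "\<sigma>\<^sup>2 = 1" for \<sigma>
    using mtrace_mult_psd_nonneg[OF psd_shifted_obs[OF A that, of 1] \<rho>(1)]
    by (simp add: mtrace_shifted_obs[OF A(1) psd_matD(1)[OF \<rho>(1)] \<rho>(2)])
  from this[of 1] this[of "-1"] show ?thesis by simp
qed

lemma learnable_by_random_observable:
  assumes Obs: "\<And>x. x < M \<Longrightarrow> Obs x \<in> carrier_mat (2 ^ n) (2 ^ n)"
      "\<And>x. x < M \<Longrightarrow> hermitian_mat (Obs x)" "\<And>x. x < M \<Longrightarrow> op_norm (Obs x) \<le> 1"
    and M: "M > 0" and \<epsilon>: "0 < \<epsilon>" "\<epsilon> \<le> 1"
  shows "\<exists>(T::nat) (A::algorithm). real T \<le> 146 * (real M * ln (real M + 1)) / \<epsilon>\<^sup>2 \<and> valid_algorithm n A \<and>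
    (\<forall>\<rho>. is_state n \<rho> \<longrightarrow> success_prob \<rho> T A Obs M \<epsilon> \<ge> 0.99)"
proof -
  define F where "F = (\<lambda>(x, \<sigma>). shifted_obs (2 ^ n) (1 / (2 * M)) \<sigma> (Obs x))"
  \<comment> \<open>The factor \<open>M\<close> undoes the chance \<open>1 / M\<close> of measuring
    the observable \<open>y\<close>. The second moment is then exactly \<open>M\<close>.\<close>
  define f where "f y = (\<lambda>(x, \<sigma>). if x = y then \<sigma> * real M else 0)" for y :: nat
  have trF: "Re (mtrace (F (x, \<sigma>) * \<rho>)) = (1 + \<sigma> * Re (mtrace (Obs x * \<rho>))) / (2 * M)"
    if "is_state n \<rho>" "x < M" for \<rho> x \<sigma>
    using that mtrace_shifted_obs[OF Obs(1), of x \<rho>]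
    by (auto simp: F_def is_state_def dest: psd_matD(1))
  show ?thesis
  proof (rule learnable_from_single_copy_estimator[where I = "{..<M} \<times> {1, -1}" and F = F and f = f])
    show "psd_mat (2 ^ n) (F s)" if "s \<in> {..<M} \<times> {1, -1}" for s
      using that Obs by (auto simp: F_def intro!: psd_shifted_obs)
    show "(\<Sum>s\<in>{..<M} \<times> {1, -1}. F s $$ (i,j)) = (if i = j then 1 else 0)"
      if "i < 2 ^ n" "j < 2 ^ n" for i j
      using that M by (simp add: sum.cartesian_product' F_def shifted_obs_def algebra_simps)
    fix \<rho> x assume \<rho>: "is_state n \<rho>" and x: "x < M"
    \<comment> \<open>Only the two outcomes that belong to \<open>x\<close> survive. Taking
      \<open>g\<close> as the identity and as the square yields both moments.\<close>
    have pick: "(\<Sum>s\<in>{..<M} \<times> {1, -1}. Re (mtrace (F s * \<rho>)) * g (f x s))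
        = Re (mtrace (F (x, 1) * \<rho>)) * g M + Re (mtrace (F (x, -1) * \<rho>)) * g (- M)"
      if "g 0 = 0" for g :: "real \<Rightarrow> real"
    proof -
      have "(\<Sum>s\<in>{..<M} \<times> {1, -1}. Re (mtrace (F s * \<rho>)) * g (f x s))
          = (\<Sum>y<M. if y = x then Re (mtrace (F (x, 1) * \<rho>)) * g M + Re (mtrace (F (x, -1) * \<rho>)) * g (- M) else 0)"
        unfolding sum.cartesian_product'
        by (rule sum.cong) (use that in \<open>auto simp: f_def\<close>)
      then show ?thesis using x by simp
    qed
    show "(\<Sum>s\<in>{..<M} \<times> {1, -1}. Re (mtrace (F s * \<rho>)) * f x s) = Re (mtrace (Obs x * \<rho>))"
      using pick[of "\<lambda>y. y"] M by (simp add: trF[OF \<rho> x] field_simps)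
    show "(\<Sum>s\<in>{..<M} \<times> {1, -1}. Re (mtrace (F s * \<rho>)) * (f x s)\<^sup>2) \<le> 4 * real M"
      using pick[of "\<lambda>y. y\<^sup>2"] M by (simp add: trF[OF \<rho> x] field_simps power2_eq_square)
  qed (use M \<epsilon> in \<open>auto simp: f_def\<close>)
qed

subsection \<open>Interference of two basis vectors\<close>

text \<open>The case \<open>i = j\<close> is allowed and gives \<open>1 + c\<close> times a basis
  vector, which is zero for \<open>c = -1\<close>; sums over pairs then run over the full square of
  indices.\<close>

definition pair_vec :: "nat \<Rightarrow> nat \<Rightarrow> complex \<Rightarrow> nat \<Rightarrow> complex" where
  "pair_vec i j c a = of_bool (a = i) + c * of_bool (a = j)"

definition pair_proj :: "nat \<Rightarrow> nat \<Rightarrow> nat \<Rightarrow> complex \<Rightarrow> complex mat" where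
  "pair_proj d i j c = Matrix.mat d d (\<lambda>(a,b). pair_vec i j c a * cnj (pair_vec i j c b) / of_nat (8 * d))"

lemma sum_mult_pair_vec:
  assumes "i < d" "j < d"
  shows "(\<Sum>a<d. g a * pair_vec i j c a) = g i + c * g j"
proof -
  have "(\<Sum>a<d. g a * pair_vec i j c a) = (\<Sum>a<d. (if a = i then g i else 0) + (if a = j then c * g j else 0))"
    by (intro sum.cong refl) (simp add: pair_vec_def algebra_simps)
  then show ?thesis using assms by (simp add: sum.distrib)
qed

lemma sum_mult_cnj_pair_vec:
  assumes "i < d" "j < d"
  shows "(\<Sum>a<d. cnj (pair_vec i j c a) * g a) = g i + cnj c * g j"
  using arg_cong[OF sum_mult_pair_vec[OF assms, of "\<lambda>a. cnj (g a)" c], of cnj]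
  by (simp add: mult.commute)

lemma sum_fourth_roots:
  "(\<Sum>k<4. g (\<i> ^ k)) = g 1 + g \<i> + g (- 1) + g (- \<i>)"
  by (simp add: eval_nat_numeral algebra_simps)

lemma psd_pair_proj: "psd_mat d (pair_proj d i j c)"
proof (rule psd_matI)
  fix v
  have "quad_form d (\<lambda>a b. pair_proj d i j c $$ (a,b)) v
      = (\<Sum>a<d. \<Sum>b<d. cnj (v a) * (pair_vec i j c a * cnj (pair_vec i j c b)) * v b / of_nat (8 * d))"
    unfolding quad_form_def by (intro sum.cong refl) (simp add: pair_proj_def)
  also have "\<dots> = of_real ((cmod (\<Sum>b<d. cnj (pair_vec i j c b) * v b))\<^sup>2) / of_nat (8 * d)"
    unfolding sum_cnj_mult_sum[symmetric] by (simp only: sum_divide_distrib)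
  also have "\<dots> = of_real ((cmod (\<Sum>b<d. cnj (pair_vec i j c b) * v b))\<^sup>2 / (8 * d))"
    by simp
  finally show "0 \<le> Re (quad_form d (\<lambda>a b. pair_proj d i j c $$ (a,b)) v)"
    by (simp only: Re_complex_of_real) simp
qed (simp_all add: pair_proj_def)

text \<open>This is the quadratic form of \<open>\<rho>\<close> at the conjugate-paired vector
  \<open>pair_vec i j c\<close>, over \<open>8 * d\<close>. Unit modulus removes \<open>c\<close>
  from the second diagonal entry, and Hermitian symmetry merges the cross terms into twice a real
  part.\<close>

lemma mtrace_pair_proj:
  assumes \<rho>: "psd_mat d \<rho>" and ij: "i < d" "j < d" and c: "cmod c = 1"
  shows "Re (mtrace (pair_proj d i j c * \<rho>))
    = (Re (\<rho> $$ (i,i)) + Re (\<rho> $$ (j,j)) + 2 * Re (c * \<rho> $$ (i,j))) / (8 * d)"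
proof -
  have "mtrace (pair_proj d i j c * \<rho>) = (\<Sum>a<d. \<Sum>b<d. pair_proj d i j c $$ (a,b) * \<rho> $$ (b,a))"
    using psd_matD(1)[OF \<rho>] by (intro mtrace_mult) (simp_all add: pair_proj_def)
  also have "\<dots> = (\<Sum>a<d. (\<Sum>b<d. cnj (pair_vec i j c b) * \<rho> $$ (b,a)) * pair_vec i j c a / of_nat (8 * d))"
    unfolding sum_distrib_right sum_divide_distrib
    by (intro sum.cong refl) (simp add: pair_proj_def mult_ac)
  also have "\<dots> = (\<Sum>a<d. (\<rho> $$ (i,a) + cnj c * \<rho> $$ (j,a)) * pair_vec i j c a) / of_nat (8 * d)"
    by (simp only: sum_mult_cnj_pair_vec[OF ij] sum_divide_distrib)
  also have "\<dots> = (\<rho> $$ (i,i) + cnj c * \<rho> $$ (j,i) + c * (\<rho> $$ (i,j) + cnj c * \<rho> $$ (j,j))) / of_nat (8 * d)"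
    by (simp only: sum_mult_pair_vec[OF ij])
  also have "\<dots> = (\<rho> $$ (i,i) + \<rho> $$ (j,j) + (c * \<rho> $$ (i,j) + cnj (c * \<rho> $$ (i,j)))) / of_nat (8 * d)"
  proof -
    have "\<rho> $$ (j,i) = cnj (\<rho> $$ (i,j))" using psd_matD(2)[OF \<rho> ij(2,1)] .
    moreover have "c * cnj c = 1" using c by (simp add: complex_norm_square[symmetric])
    ultimately show ?thesis by (simp add: algebra_simps flip: mult.assoc)
  qed
  also have "\<dots> = (\<rho> $$ (i,i) + \<rho> $$ (j,j) + of_real (2 * Re (c * \<rho> $$ (i,j)))) / of_real (8 * d)"
    by (simp only: complex_add_cnj) simp
  finally show ?thesis by (simp only: Re_divide_of_real) simp
qed

text \<open>The fourth roots of unity sum to zero, so the cross terms cancel and each pair leaves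
  four times its two diagonal units. Over all pairs every diagonal position is hit
  \<open>2 * d\<close> times, which explains the normalisation \<open>8 * d\<close>.\<close>

lemma sum_pair_proj:
  assumes "a < d" "b < d"
  shows "(\<Sum>i<d. \<Sum>j<d. \<Sum>k<4. pair_proj d i j (\<i> ^ k) $$ (a,b)) = (if a = b then 1 else 0)"
proof -
  have "(\<Sum>k<4. pair_proj d i j (\<i> ^ k) $$ (a,b))
      = 4 * (of_bool (a = i) * of_bool (b = i) + of_bool (a = j) * of_bool (b = j)) / of_nat (8 * d)" for i j
    unfolding sum_fourth_roots[of "\<lambda>c. pair_proj d i j c $$ (a,b)"] using assms
    by (simp add: pair_proj_def pair_vec_def add_divide_distrib[symmetric] algebra_simps)
  moreover have "(\<Sum>i<d. of_bool (a = i) * of_bool (b = i)) = (of_bool (a = b) :: complex)"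
    using assms by (simp add: of_bool_def if_distrib[of "\<lambda>x. x * _"] cong: if_cong)
  ultimately show ?thesis using assms
    by (simp add: sum_divide_distrib[symmetric] sum_distrib_left[symmetric] sum.distrib)
qed

lemma learnable_by_pair_interference:
  assumes Obs: "\<And>x. x < M \<Longrightarrow> Obs x \<in> carrier_mat (2 ^ n) (2 ^ n)"
      "\<And>x. x < M \<Longrightarrow> hermitian_mat (Obs x)" "\<And>x. x < M \<Longrightarrow> op_norm (Obs x) \<le> 1"
    and M: "M > 0" and \<epsilon>: "0 < \<epsilon>" "\<epsilon> \<le> 1"
  shows "\<exists>(T::nat) (A::algorithm). real T \<le> 146 * (2 ^ n * ln (real M + 1)) / \<epsilon>\<^sup>2 \<and> valid_algorithm n A \<and>
    (\<forall>\<rho>. is_state n \<rho> \<longrightarrow> success_prob \<rho> T A Obs M \<epsilon> \<ge> 0.99)"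
proof -
  define d where "d = (2 ^ n :: nat)"
  have d: "d > 0" "real d = 2 ^ n" by (simp_all add: d_def)
  define I where "I = {..<d} \<times> {..<d} \<times> {..<4 :: nat}"
  define F where "F = (\<lambda>(i, j, k :: nat). pair_proj d i j (\<i> ^ k))"
  \<comment> \<open>The sum over the four phases of \<open>2 * Re (c * a) * Re (c * b)\<close> is
    \<open>4 * Re (cnj b * a)\<close>; against the probability weight \<open>1 / (8 * d)\<close>
    this calls for the factor \<open>2 * d\<close>.\<close>
  define f where "f x = (\<lambda>(i, j, k :: nat). 2 * d * Re (\<i> ^ k * Obs x $$ (i,j)))" for x
  have sumI: "(\<Sum>s\<in>I. g s) = (\<Sum>i<d. \<Sum>j<d. \<Sum>k<4. g (i, j, k))" for g :: "_ \<Rightarrow> 'b :: comm_monoid_add"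
    by (simp add: I_def sum.cartesian_product')
  show ?thesis
    unfolding d(2)[symmetric]
  proof (rule learnable_from_single_copy_estimator[where I = I and F = F and f = f])
    show "psd_mat (2 ^ n) (F s)" if "s \<in> I" for s
      by (cases s) (auto simp: F_def d_def intro: psd_pair_proj)
    show "(\<Sum>s\<in>I. F s $$ (i,j)) = (if i = j then 1 else 0)" if "i < 2 ^ n" "j < 2 ^ n" for i j
      using that sum_pair_proj[of i d j] by (simp add: sumI F_def d_def)
    show "\<bar>f x s\<bar> \<le> 2 * real d" if x: "x < M" and s: "s \<in> I" for x s
    proof -
      obtain i j k where s': "s = (i, j, k)" "i < d" "j < d" using s by (auto simp: I_def)
      have "\<bar>Re (\<i> ^ k * Obs x $$ (i,j))\<bar> \<le> cmod (\<i> ^ k * Obs x $$ (i,j))" by (rule abs_Re_le_cmod)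
      also have "\<dots> \<le> 1"
        using contraction_entry_le[OF Obs(1,3)[OF x]] s' by (simp add: norm_mult norm_power d_def)
      finally have "2 * real d * \<bar>Re (\<i> ^ k * Obs x $$ (i,j))\<bar> \<le> 2 * real d"
        by (rule mult_left_le) simp
      then show ?thesis by (simp add: f_def s' abs_mult)
    qed
    fix \<rho> x assume "is_state n \<rho>" and x: "x < M"
    then have \<rho>: "psd_mat d \<rho>" "mtrace \<rho> = 1" by (auto simp: is_state_def d_def)
    note O = Obs[OF x, folded d_def]
    define r where "r i = Re (\<rho> $$ (i,i))" for i
    have r: "(\<Sum>i<d. r i) = 1"
      using \<rho>(2) psd_matD(1)[OF \<rho>(1)] by (simp add: r_def mtrace_def flip: Re_sum)
    have r0: "r i \<ge> 0" if "i < d" for i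
      using psd_matD(3)[OF \<rho>(1), of "\<lambda>a. of_bool (a = i)"] that
      by (simp add: r_def quad_form_def of_bool_def if_distrib[of "\<lambda>x. _ * x"] if_distrib[of "\<lambda>x. x * _"]
          if_distrib[of cnj] cong: if_cong)
    have p: "Re (mtrace (F (i, j, k) * \<rho>)) = (r i + r j + 2 * Re (\<i> ^ k * \<rho> $$ (i,j))) / (8 * d)"
      if "i < d" "j < d" for i j k
      using mtrace_pair_proj[OF \<rho>(1) that] by (simp add: F_def r_def norm_power)
    \<comment> \<open>The diagonal part of the probability is constant in the phase and multiplies a
      sum that vanishes; only the off-diagonal entry of the state contributes to the mean.\<close>
    have "(\<Sum>k<4. Re (mtrace (F (i, j, k) * \<rho>)) * f x (i, j, k)) = Re (Obs x $$ (j,i) * \<rho> $$ (i,j))"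
      if ij: "i < d" "j < d" for i j
    proof -
      have "(\<Sum>k<4. Re (mtrace (F (i, j, k) * \<rho>)) * f x (i, j, k))
          = (\<Sum>k<4. (r i + r j + 2 * Re (\<i> ^ k * \<rho> $$ (i,j))) * Re (\<i> ^ k * Obs x $$ (i,j)) / 4)"
        using d by (intro sum.cong refl) (simp add: p[OF ij] f_def field_simps)
      also have "\<dots> = Re (cnj (Obs x $$ (i,j)) * \<rho> $$ (i,j))"
        unfolding sum_fourth_roots[of "\<lambda>c. (r i + r j + 2 * Re (c * \<rho> $$ (i,j))) * Re (c * Obs x $$ (i,j)) / 4"]
        by (simp add: field_simps)
      also have "cnj (Obs x $$ (i,j)) = Obs x $$ (j,i)"
        using hermitian_matD[OF O(2,1) ij(2,1)] by simp
      finally show ?thesis .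
    qed
    then have "(\<Sum>s\<in>I. Re (mtrace (F s * \<rho>)) * f x s) = (\<Sum>i<d. \<Sum>j<d. Re (Obs x $$ (j,i) * \<rho> $$ (i,j)))"
      unfolding sumI by (intro sum.cong refl) auto
    also have "\<dots> = (\<Sum>j<d. \<Sum>i<d. Re (Obs x $$ (j,i) * \<rho> $$ (i,j)))"
      by (rule sum.swap)
    also have "\<dots> = Re (mtrace (Obs x * \<rho>))"
      by (simp only: mtrace_mult[OF O(1) psd_matD(1)[OF \<rho>(1)]] Re_sum)
    finally show "(\<Sum>s\<in>I. Re (mtrace (F s * \<rho>)) * f x s) = Re (mtrace (Obs x * \<rho>))" .
    \<comment> \<open>Now the off-diagonal entry drops out: its term is odd in the phase
      \<open>c\<close>, and the four phases are closed under negation. The squares sum to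
      \<open>2 * (cmod (Obs x $$ (i,j)))^2\<close>.\<close>
    have "(\<Sum>k<4. Re (mtrace (F (i, j, k) * \<rho>)) * (f x (i, j, k))\<^sup>2)
        = d * (r i * (cmod (Obs x $$ (j,i)))\<^sup>2) + d * (r j * (cmod (Obs x $$ (i,j)))\<^sup>2)"
      if ij: "i < d" "j < d" for i j
    proof -
      have "(\<Sum>k<4. Re (mtrace (F (i, j, k) * \<rho>)) * (f x (i, j, k))\<^sup>2)
          = (\<Sum>k<4. d * ((r i + r j + 2 * Re (\<i> ^ k * \<rho> $$ (i,j))) * (Re (\<i> ^ k * Obs x $$ (i,j)))\<^sup>2 / 2))"
        using d by (intro sum.cong refl) (simp add: p[OF ij] f_def field_simps power2_eq_square)
      also have "\<dots> = d * ((r i + r j) * (cmod (Obs x $$ (i,j)))\<^sup>2)"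
        unfolding sum_fourth_roots[of "\<lambda>c. d * ((r i + r j + 2 * Re (c * \<rho> $$ (i,j))) * (Re (c * Obs x $$ (i,j)))\<^sup>2 / 2)"]
        unfolding cmod_power2 by (simp add: field_simps power2_eq_square)
      also have "cmod (Obs x $$ (i,j)) = cmod (Obs x $$ (j,i))"
        using hermitian_matD[OF O(2,1) ij] by simp
      finally show ?thesis
        using hermitian_matD[OF O(2,1) ij] by (simp add: algebra_simps)
    qed
    then have "(\<Sum>s\<in>I. Re (mtrace (F s * \<rho>)) * (f x s)\<^sup>2)
        = (\<Sum>i<d. \<Sum>j<d. d * (r i * (cmod (Obs x $$ (j,i)))\<^sup>2) + d * (r j * (cmod (Obs x $$ (i,j)))\<^sup>2))"
      unfolding sumI by (intro sum.cong refl) auto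
    \<comment> \<open>Swapping the sums in the second half makes both halves column norms of
      \<open>Obs x\<close> weighted by the diagonal of the state, so each is at most
      \<open>d\<close>.\<close>
    also have "\<dots> = (\<Sum>i<d. \<Sum>j<d. d * (r i * (cmod (Obs x $$ (j,i)))\<^sup>2))
        + (\<Sum>j<d. \<Sum>i<d. d * (r j * (cmod (Obs x $$ (i,j)))\<^sup>2))"
      unfolding sum.distrib by (intro arg_cong2[where f = "(+)"] refl sum.swap)
    also have "\<dots> = 2 * (\<Sum>i<d. d * (r i * (\<Sum>j<d. (cmod (Obs x $$ (j,i)))\<^sup>2)))"
      by (simp add: sum_distrib_left)
    also have "\<dots> \<le> 2 * (\<Sum>i<d. d * (r i * 1))"
      using r0 contraction_column_le[OF O(1,3)] by (intro mult_left_mono sum_mono) auto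
    also have "\<dots> = 2 * real d" by (simp add: sum_distrib_left[symmetric] r)
    finally show "(\<Sum>s\<in>I. Re (mtrace (F s * \<rho>)) * (f x s)\<^sup>2) \<le> 4 * real d" by simp
  qed (use d M \<epsilon> in \<open>auto simp: I_def\<close>)
qed

section \<open>Trivial accuracy with zero copies, and the choice between the two
  measurements\<close>

lemma success_prob_zero_copies:
  assumes "\<And>x. x < M \<Longrightarrow> \<bar>Re (mtrace (Obs x * \<rho>))\<bar> \<le> \<epsilon>"
  shows "success_prob \<rho> 0 (return_pmf (S, \<lambda>_ _. 0)) Obs M \<epsilon> = 1"
proof -
  have "histories S 0 = {[]}" by (auto simp: histories_def)
  then show ?thesis
    using assms by (simp add: success_prob_def det_success_prob_def hist_prob_def)
qed

text \<open>\<open>valid_strategy\<close> asks for a POVM after every history, so even an algorithm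
  with zero rounds has to name one.\<close>

lemma is_povm_identity: "is_povm n (1, \<lambda>_. 1\<^sub>m (2 ^ n))"
proof -
  have "psd_mat d (1\<^sub>m d)" for d
  proof (rule psd_matI)
    fix v
    have "quad_form d (\<lambda>i j. 1\<^sub>m d $$ (i,j)) v = (\<Sum>i<d. of_real ((cmod (v i))\<^sup>2))"
      unfolding quad_form_def
    proof (intro sum.cong refl)
      fix i assume "i \<in> {..<d}"
      then have "(\<Sum>j<d. cnj (v i) * 1\<^sub>m d $$ (i,j) * v j) = cnj (v i) * v i"
        by (simp add: if_distrib[of "\<lambda>x. _ * x"] if_distrib[of "\<lambda>x. x * _"] cong: if_cong)
      then show "(\<Sum>j<d. cnj (v i) * 1\<^sub>m d $$ (i,j) * v j) = of_real ((cmod (v i))\<^sup>2)"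
        by (metis complex_norm_square mult.commute)
    qed
    then show "0 \<le> Re (quad_form d (\<lambda>i j. 1\<^sub>m d $$ (i,j)) v)" by (simp add: sum_nonneg)
  qed auto
  then show ?thesis by (simp add: is_povm_def)
qed

theorem mainTheorem6:
  shows "\<exists>C>0. \<forall>(n::nat) (M::nat) (Obs::nat \<Rightarrow> complex mat) (\<epsilon>::real).
     (\<forall>x<M. Obs x \<in> carrier_mat (2^n) (2^n) \<and> hermitian_mat (Obs x) \<and> op_norm (Obs x) \<le> 1) \<longrightarrow>
     \<epsilon> > 0 \<longrightarrow>
     (\<exists>(T::nat) (A::algorithm).
        real T \<le> C * min (real M * ln (real M + 1)) (2 ^ n * ln (real M + 1)) / \<epsilon>\<^sup>2 \<and>
        valid_algorithm n A \<and>
        (\<forall>\<rho>. is_state n \<rho> \<longrightarrow> success_prob \<rho> T A Obs M \<epsilon> \<ge> 0.99))"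
proof (rule exI[of _ 146], intro conjI allI impI)
  fix n M :: nat and Obs :: "nat \<Rightarrow> complex mat" and \<epsilon> :: real
  assume "\<forall>x<M. Obs x \<in> carrier_mat (2^n) (2^n) \<and> hermitian_mat (Obs x) \<and> op_norm (Obs x) \<le> 1"
    and \<epsilon>: "\<epsilon> > 0"
  then have Obs: "\<And>x. x < M \<Longrightarrow> Obs x \<in> carrier_mat (2^n) (2^n)"
    "\<And>x. x < M \<Longrightarrow> hermitian_mat (Obs x)" "\<And>x. x < M \<Longrightarrow> op_norm (Obs x) \<le> 1" by auto
  have ln0: "ln (real M + 1) \<ge> 0" by simp
  \<comment> \<open>In the first case \<open>T = 0\<close>: for \<open>M = 0\<close> the bound is
    zero, and for large \<open>\<epsilon>\<close> it can drop below 1, where rounding up is not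
    affordable. Otherwise the smaller of \<open>M\<close> and \<open>2 ^ n\<close> selects the
    measurement.\<close>
  consider "M = 0 \<or> \<epsilon> \<ge> 1" | "M > 0" "\<epsilon> \<le> 1" "real M \<le> 2 ^ n" | "M > 0" "\<epsilon> \<le> 1" "2 ^ n \<le> real M"
    by linarith
  then show "\<exists>(T::nat) (A::algorithm).
        real T \<le> 146 * min (real M * ln (real M + 1)) (2 ^ n * ln (real M + 1)) / \<epsilon>\<^sup>2 \<and>
        valid_algorithm n A \<and>
        (\<forall>\<rho>. is_state n \<rho> \<longrightarrow> success_prob \<rho> T A Obs M \<epsilon> \<ge> 0.99)"
  proof cases
    case 1
    have "\<bar>Re (mtrace (Obs x * \<rho>))\<bar> \<le> \<epsilon>" if "is_state n \<rho>" "x < M" for \<rho> x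
      using abs_expectation_le_one[OF Obs[OF that(2)], of \<rho>] that 1 by (auto simp: is_state_def)
    then show ?thesis
      using ln0 is_povm_identity[of n]
      by (intro exI[of _ 0] exI[of _ "return_pmf (\<lambda>_. (1, \<lambda>_. 1\<^sub>m (2 ^ n)), \<lambda>_ _. 0)"])
        (simp add: success_prob_zero_copies valid_algorithm_def valid_strategy_def)
  next
    case 2
    then have "min (real M * ln (real M + 1)) (2 ^ n * ln (real M + 1)) = real M * ln (real M + 1)"
      using ln0 by (simp add: min_absorb1 mult_right_mono)
    then show ?thesis using learnable_by_random_observable[of M Obs n \<epsilon>] Obs \<epsilon> 2 by simp
  next
    case 3
    then have "min (real M * ln (real M + 1)) (2 ^ n * ln (real M + 1)) = 2 ^ n * ln (real M + 1)"
      using ln0 by (simp add: min_absorb2 mult_right_mono)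
    then show ?thesis using learnable_by_pair_interference[of M Obs n \<epsilon>] Obs \<epsilon> 3 by simp
  qed
qed simp

end
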